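(* The range of possible cardinalities of finite subsets of the extended complex plane with trivial stabilizer is $$\{|\alpha| : \alpha\subseteq\widehat{\mathbb C}\text{ finite},\ \mathcal A_\alpha\text{ trivial}\}=\{5,6,7,\dots\}.$$
   Context: $\widehat{\mathbb C}=\mathbb C\cup\{\infty\}$. For $\alpha\subseteq\widehat{\mathbb C}$, $\mathcal A_\alpha$ is the group of all Möbius transformations $f\in\mathrm{PSL}(2,\mathbb C)$ with $f(\alpha)=\alpha$. *)

theory Defs
  imports "HOL-Analysis.Analysis" "HOL-Algebra.Elementary_Groups"
begin

text \<open>The extended complex plane as the one-point compactification of the complex numbers:
  \<open>None\<close> is the point at infinity.\<close>

type_synonym ext_complex = "complex option"

text \<open>Extension of \<^const>\<open>moebius\<close> to the extended plane. It is only meaningful for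
  \<open>a * d - b * c \<noteq> 0\<close>, where numerator and denominator have no common zero.\<close>

fun ext_moebius :: "complex \<Rightarrow> complex \<Rightarrow> complex \<Rightarrow> complex \<Rightarrow> ext_complex \<Rightarrow> ext_complex" where
  "ext_moebius a b c d (Some z) = (if c * z + d = 0 then None else Some (moebius a b c d z))"
| "ext_moebius a b c d None = (if c = 0 then None else Some (a / c))"

text \<open>PSL(2,C) is realised as the image of SL(2,C) in the group of self-maps of the extended
  plane; the kernel of this action is \<open>{I, -I}\<close>, see \<open>ext_moebius_eq_id_iff\<close>.\<close>

definition PSL2C :: "(ext_complex \<Rightarrow> ext_complex) monoid" where
  "PSL2C = \<lparr>carrier = {ext_moebius a b c d | a b c d. a * d - b * c = 1}, mult = (\<circ>), one = id\<rparr>"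

definition stab_group :: "ext_complex set \<Rightarrow> (ext_complex \<Rightarrow> ext_complex) monoid" where
  "stab_group \<alpha> = PSL2C \<lparr>carrier := {f \<in> carrier PSL2C. f ` \<alpha> = \<alpha>}\<rparr>"

lemma ext_moebius_id: "ext_moebius 1 0 0 1 = id"
proof
  fix x show "ext_moebius 1 0 0 1 x = id x"
    by (cases x) (auto simp: moebius_def)
qed

lemma ext_moebius_scale:
  assumes "k \<noteq> 0"
  shows "ext_moebius (k * a) (k * b) (k * c) (k * d) = ext_moebius a b c d"
proof
  fix x
  have "k * c * z + k * d = k * (c * z + d)" "k * a * z + k * b = k * (a * z + b)" for z
    by (simp_all add: algebra_simps)
  then show "ext_moebius (k * a) (k * b) (k * c) (k * d) x = ext_moebius a b c d x"
    using assms by (cases x) (auto simp: moebius_def)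
qed

text \<open>Normalising the determinant to 1 loses no maps.\<close>

lemma carrier_PSL2C_eq:
  "carrier PSL2C = {ext_moebius a b c d | a b c d. a * d - b * c \<noteq> 0}"
proof -
  have "\<exists>a' b' c' d'. ext_moebius a b c d = ext_moebius a' b' c' d' \<and> a' * d' - b' * c' = 1"
    if D: "a * d - b * c \<noteq> 0" for a b c d
  proof -
    define k where "k = 1 / csqrt (a * d - b * c)"
    have k: "k \<noteq> 0" "k\<^sup>2 * (a * d - b * c) = 1"
      using D by (auto simp: k_def power_divide)
    have "(k * a) * (k * d) - (k * b) * (k * c) = 1"
      using k(2) by (simp add: algebra_simps power2_eq_square)
    then show ?thesis
      using ext_moebius_scale[OF k(1)] by metis
  qed
  then show ?thesis
    unfolding PSL2C_def by (fastforce simp del: ext_moebius.simps)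
qed

lemma ext_moebius_comp:
  assumes "a * d - b * c \<noteq> 0" "a' * d' - b' * c' \<noteq> 0"
  shows "ext_moebius a b c d \<circ> ext_moebius a' b' c' d' =
    ext_moebius (a * a' + b * c') (a * b' + b * d') (c * a' + d * c') (c * b' + d * d')"
proof
  fix x
  show "(ext_moebius a b c d \<circ> ext_moebius a' b' c' d') x =
    ext_moebius (a * a' + b * c') (a * b' + b * d') (c * a' + d * c') (c * b' + d * d') x"
  proof (cases x)
    case None
    show ?thesis
    proof (cases "c' = 0")
      case True
      then have "a' \<noteq> 0" using assms(2) by auto
      then show ?thesis using True None by simp
    next
      case False
      have "c * (a' / c') + d = (c * a' + d * c') / c'" "a * (a' / c') + b = (a * a' + b * c') / c'"
        using False by (simp_all add: field_simps)
      then show ?thesis using False None by (simp add: moebius_def)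
    qed
  next
    case (Some z)
    define n m where "n = a' * z + b'" and "m = c' * z + d'"
    have num: "(a * a' + b * c') * z + (a * b' + b * d') = a * n + b * m"
      and den: "(c * a' + d * c') * z + (c * b' + d * d') = c * n + d * m"
      by (simp_all add: n_def m_def algebra_simps)
    show ?thesis
    proof (cases "m = 0")
      case True
      have "a' * m - c' * n = a' * d' - b' * c'"
        by (simp add: n_def m_def algebra_simps)
      then have "n \<noteq> 0" using assms(2) True by auto
      moreover have "ext_moebius a' b' c' d' x = None"
        using Some True by (simp add: m_def)
      ultimately show ?thesis
        using Some True by (simp add: moebius_def num den)
    next
      case False
      have "ext_moebius a' b' c' d' x = Some (n / m)"
        using Some False by (simp add: n_def m_def moebius_def)
      moreover have "c * (n / m) + d = (c * n + d * m) / m" "a * (n / m) + b = (a * n + b * m) / m"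
        using False by (simp_all add: field_simps)
      ultimately show ?thesis
        using Some False by (simp add: moebius_def num den)
    qed
  qed
qed

lemma ext_moebius_left_inverse:
  assumes "a * d - b * c = 1"
  shows "ext_moebius d (- b) (- c) a \<circ> ext_moebius a b c d = id"
proof -
  have "d * a - (- b) * (- c) = 1"
    using assms by (simp add: algebra_simps)
  then have "ext_moebius d (- b) (- c) a \<circ> ext_moebius a b c d =
      ext_moebius (d * a + - b * c) (d * b + - b * d) (- c * a + a * c) (- c * b + a * d)"
    using assms by (intro ext_moebius_comp) auto
  also have "\<dots> = ext_moebius 1 0 0 1"
    using assms by (simp add: algebra_simps del: ext_moebius.simps)
  finally show ?thesis
    by (simp add: ext_moebius_id)
qed

lemma ext_moebius_eq_id_iff:
  assumes "a * d - b * c = 1"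
  shows "ext_moebius a b c d = id \<longleftrightarrow> b = 0 \<and> c = 0 \<and> a = d \<and> (d = 1 \<or> d = - 1)"
proof
  assume id: "ext_moebius a b c d = id"
  have c: "c = 0"
    using fun_cong[OF id, of None] by (simp split: if_splits)
  then have "d \<noteq> 0"
    using assms by auto
  then have b: "b = 0"
    using fun_cong[OF id, of "Some 0"] c by (simp add: moebius_def)
  have ad: "a = d"
    using fun_cong[OF id, of "Some 1"] b c \<open>d \<noteq> 0\<close> by (simp add: moebius_def)
  then have "d * d = 1"
    using assms b by simp
  then have "d = 1 \<or> d = - 1"
    using square_eq_1_iff by blast
  then show "b = 0 \<and> c = 0 \<and> a = d \<and> (d = 1 \<or> d = - 1)"
    using b c ad by blast
next
  assume "b = 0 \<and> c = 0 \<and> a = d \<and> (d = 1 \<or> d = - 1)"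
  then have "ext_moebius a b c d = ext_moebius (d * 1) (d * 0) (d * 0) (d * 1)" "d \<noteq> 0"
    by (auto simp del: ext_moebius.simps)
  then show "ext_moebius a b c d = id"
    using ext_moebius_scale[of d 1 0 0 1] ext_moebius_id by metis
qed

lemma group_PSL2C: "group PSL2C"
proof (rule groupI)
  fix f g assume "f \<in> carrier PSL2C" "g \<in> carrier PSL2C"
  then obtain a b c d a' b' c' d'
    where f: "f = ext_moebius a b c d" "a * d - b * c = 1"
      and g: "g = ext_moebius a' b' c' d'" "a' * d' - b' * c' = 1"
    unfolding PSL2C_def by auto
  have "(a * a' + b * c') * (c * b' + d * d') - (a * b' + b * d') * (c * a' + d * c')
      = (a * d - b * c) * (a' * d' - b' * c')"
    by (simp add: algebra_simps)
  also have "\<dots> = 1"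
    using f g by simp
  finally have "f \<circ> g \<in> carrier PSL2C"
    unfolding f g PSL2C_def using ext_moebius_comp[of a d b c a' d' b' c'] f(2) g(2) by auto
  then show "f \<otimes>\<^bsub>PSL2C\<^esub> g \<in> carrier PSL2C"
    by (simp add: PSL2C_def)
next
  have "id \<in> {ext_moebius a b c d | a b c d. a * d - b * c = 1}"
    using ext_moebius_id[symmetric] by force
  then show "\<one>\<^bsub>PSL2C\<^esub> \<in> carrier PSL2C"
    by (simp add: PSL2C_def)
next
  fix f assume "f \<in> carrier PSL2C"
  then obtain a b c d where f: "f = ext_moebius a b c d" "a * d - b * c = 1"
    unfolding PSL2C_def by auto
  have "d * a - (- b) * (- c) = 1"
    using f by (simp add: algebra_simps)
  then have "ext_moebius d (- b) (- c) a \<in> carrier PSL2C"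
    unfolding PSL2C_def partial_object.simps by blast
  then show "\<exists>g\<in>carrier PSL2C. g \<otimes>\<^bsub>PSL2C\<^esub> f = \<one>\<^bsub>PSL2C\<^esub>"
    using ext_moebius_left_inverse[OF f(2)] unfolding f by (intro bexI) (auto simp: PSL2C_def)
qed (auto simp: PSL2C_def)

lemma subgroup_stab: "subgroup {f \<in> carrier PSL2C. f ` \<alpha> = \<alpha>} PSL2C"
proof (rule group.subgroupI[OF group_PSL2C])
  have one: "\<one>\<^bsub>PSL2C\<^esub> = id" and mult: "\<And>f g. f \<otimes>\<^bsub>PSL2C\<^esub> g = f \<circ> g"
    by (simp_all add: PSL2C_def)
  interpret group PSL2C by (rule group_PSL2C)
  show "{f \<in> carrier PSL2C. f ` \<alpha> = \<alpha>} \<noteq> {}"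
    using one_closed one by force
  show "inv\<^bsub>PSL2C\<^esub> f \<in> {f \<in> carrier PSL2C. f ` \<alpha> = \<alpha>}"
    if "f \<in> {f \<in> carrier PSL2C. f ` \<alpha> = \<alpha>}" for f
  proof -
    have f: "f \<in> carrier PSL2C" "f ` \<alpha> = \<alpha>" using that by auto
    have "inv\<^bsub>PSL2C\<^esub> f \<circ> f = id"
      using l_inv[OF f(1)] by (simp add: one mult)
    then have "(inv\<^bsub>PSL2C\<^esub> f) ` (f ` \<alpha>) = \<alpha>"
      by (simp add: image_comp)
    then show ?thesis using f by simp
  qed
  show "f \<otimes>\<^bsub>PSL2C\<^esub> g \<in> {f \<in> carrier PSL2C. f ` \<alpha> = \<alpha>}"
    if "f \<in> {f \<in> carrier PSL2C. f ` \<alpha> = \<alpha>}" "g \<in> {f \<in> carrier PSL2C. f ` \<alpha> = \<alpha>}" for f g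
  proof -
    have "(f \<circ> g) ` \<alpha> = \<alpha>" using that by (simp only: mem_Collect_eq flip: image_comp)
    moreover have "f \<otimes>\<^bsub>PSL2C\<^esub> g \<in> carrier PSL2C" using that by simp
    ultimately show ?thesis by (simp add: mult)
  qed
qed auto

lemma group_stab_group: "group (stab_group \<alpha>)"
  unfolding stab_group_def
  by (rule subgroup.subgroup_is_group[OF subgroup_stab group_PSL2C])

end

theory Submission
  imports Defs
begin

text \<open>Up to four points, symmetry comes from involutions; beyond, rigidity of Moebius maps excludes it.

  At most four points: for disjoint pairs \<open>{p, q}\<close> and \<open>{r, s}\<close>, possibly degenerate, some
  involution exchanges \<open>p\<close> with \<open>q\<close> and \<open>r\<close> with \<open>s\<close> (\<open>moebius_involution_exists\<close>). Every
  nonempty set of at most four points is \<open>{p, q}\<close> or \<open>{p, q, r, s}\<close> for suitable such pairs, so it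
  has a nontrivial symmetry; the empty set is preserved by every map.

  Five or more points: adding a generic point \<open>z\<close> to a finite set \<open>\<beta>\<close> of at least four points
  destroys all symmetry (\<open>trivial_stab_group_generic_insert\<close>). A symmetry of \<open>\<beta> \<union> {z}\<close> sends at most
  one point of \<open>\<beta>\<close> to \<open>z\<close>, hence at least three points of \<open>\<beta>\<close> into \<open>\<beta>\<close>. Since a map is determined
  by its values at three points, only finitely many maps do this, whatever \<open>z\<close> is. If such a map is
  not the identity, being a symmetry of \<open>\<beta> \<union> {z}\<close> forces \<open>z\<close> to be one of its at most two fixed
  points or a preimage of a point of \<open>\<beta>\<close>. So only finitely many \<open>z\<close> are excluded, and every
  cardinality from five on is attained.\<close>

section \<open>Homogeneous coordinates\<close>

text \<open>A point is the ratio of \<open>hom_num\<close> and \<open>hom_den\<close>. These coordinates turn statements about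
  \<^const>\<open>ext_moebius\<close> into polynomial identities that hold at infinity as well.\<close>

fun hom_num :: "ext_complex \<Rightarrow> complex" where
  "hom_num (Some z) = z"
| "hom_num None = 1"

fun hom_den :: "ext_complex \<Rightarrow> complex" where
  "hom_den (Some z) = 1"
| "hom_den None = 0"

lemma ext_complex_eq_iff_hom: "x = y \<longleftrightarrow> hom_num x * hom_den y = hom_num y * hom_den x"
  by (cases x; cases y) auto

lemma ext_moebius_eq_iff_hom:
  assumes "a * d - b * c \<noteq> 0"
  shows "ext_moebius a b c d x = y \<longleftrightarrow>
    (a * hom_num x + b * hom_den x) * hom_den y = (c * hom_num x + d * hom_den x) * hom_num y"
proof (cases x)
  case None
  then show ?thesis
    using assms by (cases y) (auto simp: field_simps)
next
  case (Some z)
  have "a * z + b \<noteq> 0" if "c * z + d = 0"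
  proof
    assume "a * z + b = 0"
    then have "a * (c * z + d) - c * (a * z + b) = 0"
      using that by simp
    then show False
      using assms by (simp add: algebra_simps)
  qed
  then show ?thesis
    using Some by (cases y) (auto simp: moebius_def divide_eq_eq mult.commute)
qed

section \<open>Rigidity\<close>

text \<open>In an affine coordinate, a fixed point is a root of \<open>c * z\<^sup>2 + (d - a) * z - b\<close>, and infinity
  is fixed exactly when the leading coefficient vanishes. Three fixed points are thus one root too
  many, and all coefficients are zero.\<close>

lemma ext_moebius_three_fixed_points:
  assumes det: "a * d - b * c \<noteq> 0"
    and ne: "x \<noteq> y" "x \<noteq> z" "y \<noteq> z"
    and fixed: "ext_moebius a b c d x = x" "ext_moebius a b c d y = y" "ext_moebius a b c d z = z"
  shows "b = 0" "c = 0" "a = d"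
proof -
  have two: "b = 0 \<and> a = d"
    if "c = 0" "u \<noteq> v" "(a * u + b) = (c * u + d) * u" "(a * v + b) = (c * v + d) * v" for u v
  proof -
    have "(a - d) * (u - v) = (a * u + b - d * u) - (a * v + b - d * v)"
      by (simp add: algebra_simps)
    also have "\<dots> = 0"
      using that by simp
    finally have "(a - d) * (u - v) = 0" .
    then have "a = d"
      using that by simp
    then show ?thesis
      using that by simp
  qed
  have three: "c = 0"
    if "u \<noteq> v" "u \<noteq> w" "v \<noteq> w" "(a * u + b) = (c * u + d) * u" "(a * v + b) = (c * v + d) * v"
      "(a * w + b) = (c * w + d) * w" for u v w
  proof -
    \<comment> \<open>The Vandermonde cofactors of \<open>u, v, w\<close> isolate the leading coefficient of the
      quadratic.\<close>
    have "(u - v) * (u - w) * (v - w) * c =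
        (w - v) * (a * u + b - (c * u + d) * u) + (u - w) * (a * v + b - (c * v + d) * v)
        + (v - u) * (a * w + b - (c * w + d) * w)"
      by (simp add: algebra_simps)
    also have "\<dots> = 0"
      using that by simp
    finally show ?thesis
      using that by simp
  qed
  note fixed' = fixed[unfolded ext_moebius_eq_iff_hom[OF det]]
  have c: "c = 0"
    using ne fixed' three by (cases x; cases y; cases z) auto
  have "b = 0 \<and> a = d"
    using ne fixed' two[OF c] by (cases x; cases y; cases z) auto
  with c show "b = 0" "c = 0" "a = d"
    by auto
qed

lemma PSL2C_three_fixed_points:
  assumes "f \<in> carrier PSL2C" "x \<noteq> y" "x \<noteq> z" "y \<noteq> z" "f x = x" "f y = y" "f z = z"
  shows "f = id"
proof -
  obtain a b c d where f: "f = ext_moebius a b c d" "a * d - b * c \<noteq> 0"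
    using assms(1) unfolding carrier_PSL2C_eq by blast
  have "b = 0" "c = 0" "a = d"
    using ext_moebius_three_fixed_points[OF f(2) assms(2-4)] assms(5-7) f(1) by auto
  moreover from this have "d \<noteq> 0"
    using f(2) by auto
  ultimately show ?thesis
    using ext_moebius_scale[of d 1 0 0 1] f(1) ext_moebius_id by simp
qed

lemma PSL2C_left_inverse:
  assumes "f \<in> carrier PSL2C"
  obtains g where "g \<in> carrier PSL2C" "g \<circ> f = id"
proof -
  have "inv\<^bsub>PSL2C\<^esub> f \<circ> f = id"
    using group.l_inv[OF group_PSL2C assms] by (simp add: PSL2C_def)
  then show thesis
    using that group.inv_closed[OF group_PSL2C assms] by blast
qed

lemma PSL2C_inj:
  assumes "f \<in> carrier PSL2C"
  shows "inj f"
  using PSL2C_left_inverse[OF assms] by (metis inj_on_id inj_on_imageI2)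

lemma PSL2C_eq_if_agree_on_three:
  assumes "f \<in> carrier PSL2C" "g \<in> carrier PSL2C"
    and "x \<noteq> y" "x \<noteq> z" "y \<noteq> z" "f x = g x" "f y = g y" "f z = g z"
  shows "f = g"
proof -
  obtain h where h: "h \<in> carrier PSL2C" "h \<circ> g = id"
    using PSL2C_left_inverse[OF assms(2)] .
  have "h \<circ> f \<in> carrier PSL2C"
    using monoid.m_closed[OF group.is_monoid[OF group_PSL2C] h(1) assms(1)]
    by (simp add: PSL2C_def)
  moreover have "(h \<circ> f) u = u" if "f u = g u" for u
    using that fun_cong[OF h(2), of u] by simp
  ultimately have "h \<circ> f = id"
    using PSL2C_three_fixed_points[of "h \<circ> f" x y z] assms by blast
  then have "h \<circ> f = h \<circ> g"
    using h(2) by simp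
  then show ?thesis
    using PSL2C_inj[OF h(1)] by (simp add: inj_eq fun_eq_iff)
qed

lemma obtain_three_distinct:
  assumes "infinite A \<or> 3 \<le> card A"
  obtains x y z where "x \<in> A" "y \<in> A" "z \<in> A" "x \<noteq> y" "x \<noteq> z" "y \<noteq> z"
proof -
  obtain B where "B \<subseteq> A" "card B = 3"
    using assms infinite_arbitrarily_large obtain_subset_with_card_n by metis
  then show thesis
    using that unfolding card_3_iff by blast
qed

lemma finite_fixed_points:
  assumes "f \<in> carrier PSL2C" "f \<noteq> id"
  shows "finite {z. f z = z}"
proof (rule ccontr)
  assume "infinite {z. f z = z}"
  then obtain x y z where "f x = x" "f y = y" "f z = z" "x \<noteq> y" "x \<noteq> z" "y \<noteq> z"
    using obtain_three_distinct[of "{z. f z = z}"] by blast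
  then show False
    using PSL2C_three_fixed_points assms by blast
qed

section \<open>Sets of at most four points\<close>

lemma trivial_stab_group_iff:
  "trivial_group (stab_group \<alpha>) \<longleftrightarrow> (\<forall>f \<in> carrier PSL2C. f ` \<alpha> = \<alpha> \<longrightarrow> f = id)"
proof -
  have one: "\<one>\<^bsub>PSL2C\<^esub> = id"
    by (simp add: PSL2C_def)
  have "id \<in> carrier PSL2C"
    using monoid.one_closed[OF group.is_monoid[OF group_PSL2C]] one by simp
  then show ?thesis
    using group_stab_group[of \<alpha>] by (auto simp: trivial_group_def stab_group_def one)
qed

text \<open>A trace-zero map \<open>z \<mapsto> (a * z + b) / (c * z - a)\<close> is an involution, and it exchanges \<open>z\<close> and \<open>w\<close>
  exactly when \<open>c * z * w - a * (z + w) - b = 0\<close>. Imposing this for both pairs gives two linear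
  equations in \<open>(c, a, b)\<close>, solved by a cross product. The determinant of the solution is, up to
  sign, the resultant of the two quadratics with roots \<open>p, q\<close> and \<open>r, s\<close>, so it vanishes only when
  the pairs share a point. Coincidences \<open>p = q\<close> or \<open>r = s\<close> are allowed: they prescribe fixed
  points.\<close>

lemma moebius_involution_exists:
  assumes "{p, q} \<inter> {r, s} = {}"
  obtains f where "f \<in> carrier PSL2C" "f \<noteq> id" "f p = q" "f q = p" "f r = s" "f s = r"
proof -
  define c where "c = (hom_num p * hom_den q + hom_num q * hom_den p) * (hom_den r * hom_den s)
    - (hom_num r * hom_den s + hom_num s * hom_den r) * (hom_den p * hom_den q)"
  define a where "a = hom_num p * hom_num q * (hom_den r * hom_den s)
    - hom_num r * hom_num s * (hom_den p * hom_den q)"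
  define b where "b = (hom_num p * hom_den q + hom_num q * hom_den p) * (hom_num r * hom_num s)
    - (hom_num r * hom_den s + hom_num s * hom_den r) * (hom_num p * hom_num q)"
  define D where "D = (\<lambda>x y. hom_num x * hom_den y - hom_num y * hom_den x)"
  have "a * (- a) - b * c = - (D p r * D p s * D q r * D q s)"
    unfolding a_def b_def c_def D_def by algebra
  moreover have "D x y \<noteq> 0" if "x \<noteq> y" for x y
    using that ext_complex_eq_iff_hom[of x y] by (simp add: D_def)
  ultimately have det: "a * (- a) - b * c \<noteq> 0"
    using assms by auto
  let ?f = "ext_moebius a b c (- a)"
  have "?f p = q" "?f q = p" "?f r = s" "?f s = r"
    unfolding ext_moebius_eq_iff_hom[OF det] unfolding a_def b_def c_def by algebra+
  moreover have "?f \<noteq> id"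
  proof
    assume "?f = id"
    then have fixed: "?f x = x" for x
      by (simp only: id_apply)
    have ne: "None \<noteq> Some (0 :: complex)" "None \<noteq> Some (1 :: complex)" "Some 0 \<noteq> Some (1 :: complex)"
      by auto
    note scalar = ext_moebius_three_fixed_points[OF det ne fixed fixed fixed]
    have "2 * a = 0"
      using scalar(3) by (metis eq_neg_iff_add_eq_0 mult_2)
    then show False
      using det scalar(1) by simp
  qed
  moreover have "?f \<in> carrier PSL2C"
    unfolding carrier_PSL2C_eq using det by blast
  ultimately show thesis
    using that by blast
qed

text \<open>Degenerate pairs reduce all nonempty sets to the two shapes \<open>{p, q}\<close> and \<open>{p, q, r, s}\<close>; for a
  singleton the second pair lies outside the set.\<close>

lemma nontrivial_stab_group_if_card_le_4:
  assumes "finite \<alpha>" "card \<alpha> \<le> 4"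
  shows "\<not> trivial_group (stab_group \<alpha>)"
proof -
  have "\<exists>p q r s. {p, q} \<inter> {r, s} = {} \<and> (\<alpha> = {} \<or> \<alpha> = {p, q} \<or> \<alpha> = {p, q, r, s})"
  proof -
    consider "card \<alpha> = 0" | "card \<alpha> = 1" | "card \<alpha> = 2" | "card \<alpha> = 3" | "card \<alpha> = 4"
      using assms(2) by linarith
    then show ?thesis
    proof cases
      case 1
      then show ?thesis
        using assms(1) by (intro exI[of _ None] exI[of _ "Some 0"]) auto
    next
      case 2
      then obtain p where "\<alpha> = {p}"
        by (auto simp: card_1_singleton_iff)
      moreover obtain r :: ext_complex where "r \<noteq> p"
        by (metis option.distinct(1))
      ultimately show ?thesis
        by (intro exI[of _ p] exI[of _ r]) auto
    next
      case 3
      then obtain p r where "\<alpha> = {p, r}" "p \<noteq> r"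
        by (auto simp: card_2_iff)
      then have "\<alpha> = {p, p, r, r}" "{p, p} \<inter> {r, r} = {}"
        by auto
      then show ?thesis
        by blast
    next
      case 4
      then obtain p r s where "\<alpha> = {p, r, s}" "p \<noteq> r" "p \<noteq> s"
        by (auto simp: card_3_iff)
      then have "\<alpha> = {p, p, r, s}" "{p, p} \<inter> {r, s} = {}"
        by auto
      then show ?thesis
        by blast
    next
      case 5
      then obtain p q r s where "\<alpha> = {p, q, r, s}" "distinct [p, q, r, s]"
        using card_Suc_eq[of \<alpha> 3] by (auto simp: card_3_iff)
      then have "\<alpha> = {p, q, r, s}" "{p, q} \<inter> {r, s} = {}"
        by auto
      then show ?thesis
        by blast
    qed
  qed
  then obtain p q r s where "{p, q} \<inter> {r, s} = {}"
    and \<alpha>: "\<alpha> = {} \<or> \<alpha> = {p, q} \<or> \<alpha> = {p, q, r, s}"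
    by blast
  then obtain f where "f \<in> carrier PSL2C" "f \<noteq> id" "f p = q" "f q = p" "f r = s" "f s = r"
    using moebius_involution_exists by metis
  moreover from this have "f ` \<alpha> = \<alpha>"
    using \<alpha> by auto
  ultimately show ?thesis
    unfolding trivial_stab_group_iff by blast
qed

section \<open>Generic extensions of sets with at least four points\<close>

text \<open>There are finitely many choices of three source points and three target points in \<open>\<beta>\<close>, and
  each choice is realised by at most one map.\<close>

lemma finite_PSL2C_three_points_into:
  assumes "finite \<beta>"
  shows "finite {f \<in> carrier PSL2C. \<exists>x\<in>\<beta>. \<exists>y\<in>\<beta>. \<exists>z\<in>\<beta>.
    x \<noteq> y \<and> x \<noteq> z \<and> y \<noteq> z \<and> f x \<in> \<beta> \<and> f y \<in> \<beta> \<and> f z \<in> \<beta>}" (is "finite ?F")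
proof -
  define G where "G = (\<lambda>(x, y, z, x', y', z').
    {f \<in> carrier PSL2C. x \<noteq> y \<and> x \<noteq> z \<and> y \<noteq> z \<and> f x = x' \<and> f y = y' \<and> f z = z'})"
  have "finite (G t)" for t
  proof -
    obtain x y z x' y' z' where t: "t = (x, y, z, x', y', z')"
      by (cases t)
    have "f = g" if "f \<in> G t" "g \<in> G t" for f g
      using that PSL2C_eq_if_agree_on_three[of f g x y z] by (simp add: G_def t)
    then have "G t = {} \<or> (\<exists>f. G t = {f})"
      by blast
    then show ?thesis
      by auto
  qed
  moreover have "?F \<subseteq> (\<Union>t \<in> \<beta> \<times> \<beta> \<times> \<beta> \<times> \<beta> \<times> \<beta> \<times> \<beta>. G t)"
    by (fastforce simp: G_def)
  moreover have "finite (\<beta> \<times> \<beta> \<times> \<beta> \<times> \<beta> \<times> \<beta> \<times> \<beta>)"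
    using assms by simp
  ultimately show ?thesis
    using finite_subset[of ?F] finite_UN_I by blast
qed

text \<open>The finite set of candidate symmetries depends on \<open>\<beta>\<close> alone, so \<open>z\<close> can be chosen afterwards to
  defeat each of them. Four points are what guarantees that three of them stay in \<open>\<beta>\<close> when one is
  sent to \<open>z\<close>.\<close>

lemma trivial_stab_group_generic_insert:
  assumes \<beta>: "finite \<beta>" "4 \<le> card \<beta>"
  shows "finite {z. \<not> trivial_group (stab_group (insert z \<beta>))}"
proof -
  define F where "F = {f \<in> carrier PSL2C. \<exists>x\<in>\<beta>. \<exists>y\<in>\<beta>. \<exists>z\<in>\<beta>.
    x \<noteq> y \<and> x \<noteq> z \<and> y \<noteq> z \<and> f x \<in> \<beta> \<and> f y \<in> \<beta> \<and> f z \<in> \<beta>}"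
  define bad where "bad = (\<Union>f \<in> F - {id}. {z. f z = z} \<union> f -` \<beta>)"
  have "finite bad"
    using finite_PSL2C_three_points_into[OF \<beta>(1)] \<beta>(1)
    by (auto simp: bad_def F_def intro!: finite_fixed_points finite_vimageI PSL2C_inj)
  moreover have "f = id"
    if z: "z \<notin> bad" and f: "f \<in> carrier PSL2C" "f ` insert z \<beta> = insert z \<beta>" for z f
  proof (rule ccontr)
    assume "f \<noteq> id"
    define S where "S = {x \<in> \<beta>. f x \<in> \<beta>}"
    \<comment> \<open>Only \<open>z\<close> is available as an image outside \<open>\<beta>\<close>.\<close>
    have "f ` (\<beta> - S) \<subseteq> {z}"
      using f(2) by (auto simp: S_def)
    then have "card (\<beta> - S) \<le> 1"
      using card_inj_on_le[of f "\<beta> - S" "{z}"] PSL2C_inj[OF f(1)] by (simp add: inj_on_def)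
    moreover have "card (\<beta> - S) = card \<beta> - card S"
      using \<beta>(1) by (intro card_Diff_subset) (auto simp: S_def)
    ultimately have "3 \<le> card S"
      using \<beta>(2) by linarith
    then obtain x y w where "x \<in> S" "y \<in> S" "w \<in> S" "x \<noteq> y" "x \<noteq> w" "y \<noteq> w"
      using obtain_three_distinct[of S] by blast
    then have "f \<in> F - {id}"
      using f(1) \<open>f \<noteq> id\<close> by (auto simp: F_def S_def)
    moreover have "f z = z \<or> f z \<in> \<beta>"
      using f(2) by auto
    ultimately show False
      using z by (auto simp: bad_def)
  qed
  then have "{z. \<not> trivial_group (stab_group (insert z \<beta>))} \<subseteq> bad"
    unfolding trivial_stab_group_iff by blast
  ultimately show ?thesis
    by (rule finite_subset[rotated])
qed

theorem theorem14:
  shows "{card \<alpha> | \<alpha> :: ext_complex set. finite \<alpha> \<and> trivial_group (stab_group \<alpha>)} = {5..}"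
proof (intro equalityI subsetI)
  fix n
  assume "n \<in> {card \<alpha> | \<alpha> :: ext_complex set. finite \<alpha> \<and> trivial_group (stab_group \<alpha>)}"
  then show "n \<in> {5..}"
    using nontrivial_stab_group_if_card_le_4 by fastforce
next
  fix n :: nat
  assume n: "n \<in> {5..}"
  have inf: "infinite (UNIV :: ext_complex set)"
    by (simp add: infinite_UNIV_char_0)
  then obtain \<beta> :: "ext_complex set" where \<beta>: "finite \<beta>" "card \<beta> = n - 1"
    using infinite_arbitrarily_large by metis
  then have "finite {z. \<not> trivial_group (stab_group (insert z \<beta>))}"
    using n by (intro trivial_stab_group_generic_insert) auto
  then have "finite ({z. \<not> trivial_group (stab_group (insert z \<beta>))} \<union> \<beta>)"
    using \<beta>(1) by simp
  then obtain z where "trivial_group (stab_group (insert z \<beta>))" "z \<notin> \<beta>"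
    using ex_new_if_finite[OF inf] by blast
  moreover from this have "card (insert z \<beta>) = n"
    using \<beta> n by simp
  ultimately show "n \<in> {card \<alpha> | \<alpha> :: ext_complex set. finite \<alpha> \<and> trivial_group (stab_group \<alpha>)}"
    using \<beta>(1) by blast
qed

end
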